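(* Let $\widetilde M=\mathbb{C}^g/\{\widetilde\Delta\mathbb{Z}^g+\widetilde\Omega\mathbb{Z}^g\}$ be an abelian variety, where $\widetilde\Delta$ is a diagonal matrix with positive integer diagonal entries and $\widetilde\Omega$ is a symmetric complex $g\times g$ matrix with positive definite imaginary part. Let $M\subset\widetilde M$ be an abelian subvariety of dimension $n$ on which the zero divisor of $\theta(\cdot|\widetilde\Omega)$ induces a polarization of type $(\delta_1,\dots,\delta_n)$. Put $\Delta=\mathrm{diag}(\delta_1,\dots,\delta_n)$, and let $\varphi:\mathbb{C}^n/\{\Delta\mathbb{Z}^n+\Omega\mathbb{Z}^n\}\to M$, $\varphi(z)=\Phi z$, be an isomorphism, where $\Omega$ is a symmetric complex $n\times n$ matrix with positive definite imaginary part and $\Phi$ is a complex $g\times n$ matrix, such that $z\mapsto\theta(\varphi(z)|\widetilde\Omega)$ is a theta function of $\mathbb{C}^n/\{\Delta\mathbb{Z}^n+\Omega\mathbb{Z}^n\}$, and such that $$\Phi\Delta\mathbb{Z}^n\subset\widetilde\Delta\mathbb{Z}^g,\qquad \Phi\Omega=\widetilde\Omega P,\qquad P^{\top}\Phi=I_n,\qquad \Omega=P^{\top}\widetilde\Omega P$$ for an integer $g\times n$ matrix $P$. Then for all $z\in\mathbb{C}^n$ and all $\gamma=(\gamma_1,\dots,\gamma_g)^{\top}\in\mathbb{C}^g$ $$\theta(\varphi(z)-\gamma|\widetilde\Omega)=\sum_{\varepsilon\in\mathbb{Z}^n/\Delta\mathbb{Z}^n}c_\varepsilon\,\theta[\Delta^{-1}\varepsilon,0](z-P^{\top}\gamma|\Omega),$$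 where $$c_\varepsilon=\sum_{\substack{m\in\mathbb{Z}^g\\ \Phi^{\top}m=\Delta^{-1}\varepsilon}}\exp\Bigl(\pi i\langle m,\widetilde\Omega m\rangle-2\pi i\langle m,\gamma\rangle+2\pi i\langle\varepsilon,\Delta^{-1}P^{\top}\gamma\rangle-\pi i\langle\Delta^{-1}\varepsilon,\Omega\Delta^{-1}\varepsilon\rangle\Bigr).$$
   Context: $\langle x,y\rangle=\sum_j x_jy_j$ (bilinear). For a symmetric $k\times k$ matrix $\Omega$ with positive definite imaginary part and $a,b\in\mathbb{C}^k$, $$\theta[a,b](z|\Omega)=\sum_{n\in\mathbb{Z}^k}\exp\bigl(\pi i\langle n+a,\Omega(n+a)\rangle+2\pi i\langle n+a,z+b\rangle\bigr),\qquad \theta(z|\Omega)=\theta[0,0](z|\Omega).$$ In $\theta(\varphi(z)-\gamma|\widetilde\Omega)$, $\varphi(z)$ denotes the vector $\Phi z\in\mathbb{C}^g$. A theta function of $\mathbb{C}^n/\{\Delta\mathbb{Z}^n+\Omega\mathbb{Z}^n\}$ is an entire function $f$ on $\mathbb{C}^n$, not identically zero here, with $f(z+\lambda)=f(z)$ for $\lambda\in\Delta\mathbb{Z}^n$ and $f(z+\Omega e_j)=\exp(-\pi i\,\Omega_{jj}-2\pi i z_j)f(z)$ for $1\le j\le n$, where $e_j$ is the $j$-th standard basis vector. The sum over $\varepsilon$ is over a set of representatives of $\mathbb{Z}^n/\Delta\mathbb{Z}^n$; for each class the same representative is used in $c_\varepsilon$ and in $\theta[\Delta^{-1}\varepsilon,0]$.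 *)

theory Defs
  imports "HOL-Analysis.Analysis"
begin

text \<open>
  A matrix of type \<open>complex^'n^'m\<close> has rows indexed by \<open>'m\<close> and columns by \<open>'n\<close>.  Indices of
  \<open>\<delta>\<^sub>1, \<dots>, \<delta>\<^sub>n\<close> are ordered by the order of the index type.
\<close>

definition cvec :: "int^'k \<Rightarrow> complex^'k" where
  "cvec m = (\<chi> i. of_int (m $ i))"

definition cmat :: "int^'n^'m \<Rightarrow> complex^'n^'m" where
  "cmat A = (\<chi> i j. of_int (A $ i $ j))"

definition cdiag :: "int^'k \<Rightarrow> complex^'k^'k" where
  "cdiag d = (\<chi> i j. if i = j then of_int (d $ i) else 0)"

text \<open>The pairing is complex bilinear, unlike the real inner product of the library on
  \<open>complex^'k\<close>.\<close>

definition bil :: "complex^'k \<Rightarrow> complex^'k \<Rightarrow> complex" where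
  "bil x y = (\<Sum>j\<in>UNIV. x $ j * y $ j)"

definition siegel :: "complex^'k^'k \<Rightarrow> bool" where
  "siegel \<Omega> \<longleftrightarrow> transpose \<Omega> = \<Omega> \<and>
     (\<forall>x :: real^'k. x \<noteq> 0 \<longrightarrow> 0 < x \<bullet> ((\<chi> i j. Im (\<Omega> $ i $ j)) *v x))"

definition theta_char :: "complex^'k \<Rightarrow> complex^'k \<Rightarrow> complex^'k \<Rightarrow> complex^'k^'k \<Rightarrow> complex" where
  "theta_char a b z \<Omega> = (\<Sum>\<^sub>\<infinity> n :: int^'k.
     exp (pi * \<i> * bil (cvec n + a) (\<Omega> *v (cvec n + a)) + 2 * pi * \<i> * bil (cvec n + a) (z + b)))"

definition theta :: "complex^'k \<Rightarrow> complex^'k^'k \<Rightarrow> complex" where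
  "theta z \<Omega> = theta_char 0 0 z \<Omega>"

definition entire :: "(complex^'k \<Rightarrow> complex) \<Rightarrow> bool" where
  "entire f \<longleftrightarrow> (\<forall>z. \<exists>D. (f has_derivative D) (at z) \<and> (\<forall>c v. D (c *s v) = c * D v))"

definition period_lattice :: "int^'k \<Rightarrow> complex^'k^'k \<Rightarrow> (complex^'k) set" where
  "period_lattice d \<Omega> = {cdiag d *v cvec m + \<Omega> *v cvec k | m k. True}"

definition theta_function :: "int^'k \<Rightarrow> complex^'k^'k \<Rightarrow> (complex^'k \<Rightarrow> complex) \<Rightarrow> bool" where
  "theta_function d \<Omega> f \<longleftrightarrow> entire f \<and> (\<exists>z. f z \<noteq> 0) \<and>
     (\<forall>z m. f (z + cdiag d *v cvec m) = f z) \<and>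
     (\<forall>z j. f (z + \<Omega> *v axis j 1) = exp (- (pi * \<i> * \<Omega> $ j $ j) - 2 * pi * \<i> * z $ j) * f z)"

definition torus_class :: "(complex^'k) set \<Rightarrow> complex^'k \<Rightarrow> (complex^'k) set" where
  "torus_class \<Lambda> z = {w. w - z \<in> \<Lambda>}"

definition torus :: "(complex^'k) set \<Rightarrow> (complex^'k) set set" where
  "torus \<Lambda> = range (torus_class \<Lambda>)"

text \<open>\<open>independent\<close> and \<open>span\<close> are taken over the reals, \<open>vec.subspace\<close> and \<open>vec.dim\<close> over the
  complex numbers.\<close>

definition full_lattice :: "(complex^'k) set \<Rightarrow> (complex^'k) set \<Rightarrow> bool" where
  "full_lattice V L \<longleftrightarrow> (\<exists>B. independent B \<and> span B = V \<and>
     L = {(\<Sum>b\<in>B. of_int (m b) *\<^sub>R b) | m :: complex^'k \<Rightarrow> int. True})"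

text \<open>A polarization of the torus \<open>V/L\<close>, given by the imaginary part \<open>E\<close> of a positive definite
  Hermitian form \<open>E (\<i> v) w + \<i> E v w\<close>.\<close>

definition polarization ::
  "(complex^'k) set \<Rightarrow> (complex^'k) set \<Rightarrow> (complex^'k \<Rightarrow> complex^'k \<Rightarrow> real) \<Rightarrow> bool" where
  "polarization V L E \<longleftrightarrow>
     (\<forall>u\<in>V. \<forall>v\<in>V. \<forall>w\<in>V. \<forall>a b. E (a *\<^sub>R u + b *\<^sub>R v) w = a * E u w + b * E v w) \<and>
     (\<forall>u\<in>V. \<forall>v\<in>V. E v u = - E u v) \<and>
     (\<forall>u\<in>L. \<forall>v\<in>L. E u v \<in> \<int>) \<and>
     (\<forall>u\<in>V. \<forall>v\<in>V. E (\<i> *s u) (\<i> *s v) = E u v) \<and>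
     (\<forall>v\<in>V. v \<noteq> 0 \<longrightarrow> 0 < E (\<i> *s v) v)"

definition abelian_variety :: "(complex^'k) set \<Rightarrow> bool" where
  "abelian_variety \<Lambda> \<longleftrightarrow> full_lattice UNIV \<Lambda> \<and> (\<exists>E. polarization UNIV \<Lambda> E)"

text \<open>\<open>M\<close> is the subtorus \<open>V / (V \<inter> \<Lambda>)\<close> of the torus with lattice \<open>\<Lambda>\<close>; \<open>V\<close> is determined by \<open>M\<close>
  as its tangent space.\<close>

definition subtorus :: "(complex^'k) set \<Rightarrow> (complex^'k) set \<Rightarrow> (complex^'k) set set \<Rightarrow> bool" where
  "subtorus \<Lambda> V M \<longleftrightarrow>
     vec.subspace V \<and> full_lattice V (V \<inter> \<Lambda>) \<and> M = torus_class \<Lambda> ` V"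

definition abelian_subvariety :: "(complex^'k) set \<Rightarrow> (complex^'k) set set \<Rightarrow> nat \<Rightarrow> bool" where
  "abelian_subvariety \<Lambda> M n \<longleftrightarrow>
     (\<exists>V. subtorus \<Lambda> V M \<and> vec.dim V = n \<and> (\<exists>E. polarization V (V \<inter> \<Lambda>) E))"

text \<open>If \<open>f\<close> has factor of automorphy \<open>exp (2 \<pi> \<i> h\<^sub>u)\<close>, \<open>u \<in> \<Lambda>\<close>, with respect to \<open>\<Lambda>\<close>, its zero divisor
  descends to the torus, and the alternating form below represents the first Chern class of the
  associated line bundle.  It depends neither on the choice of the logarithms \<open>h\<^sub>u\<close> nor on the
  choice of \<open>f\<close> among functions with the same divisor.  The sign is the one for which a
  non-degenerate \<open>f\<close> has a positive definite Hermitian form as in \<open>polarization\<close>.\<close>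

definition divisor_form ::
  "(complex^'k) set \<Rightarrow> (complex^'k \<Rightarrow> complex) \<Rightarrow> (complex^'k \<Rightarrow> complex^'k \<Rightarrow> real) \<Rightarrow> bool" where
  "divisor_form \<Lambda> f E \<longleftrightarrow> entire f \<and> (\<exists>z. f z \<noteq> 0) \<and>
     (\<exists>h. (\<forall>u\<in>\<Lambda>. entire (h u) \<and> (\<forall>z. f (z + u) = exp (2 * pi * \<i> * h u z) * f z)) \<and>
          (\<forall>u\<in>\<Lambda>. \<forall>v\<in>\<Lambda>. \<forall>z.
             of_real (E u v) = h v (z + u) + h u z - h u (z + v) - h v z))"

definition form_type ::
  "(complex^'k) set \<Rightarrow> (complex^'k \<Rightarrow> complex^'k \<Rightarrow> real) \<Rightarrow> int^('n::{finite,linorder}) \<Rightarrow> bool" where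
  "form_type L E \<delta> \<longleftrightarrow>
     (\<forall>i. 0 < \<delta> $ i) \<and> (\<forall>i j. i \<le> j \<longrightarrow> \<delta> $ i dvd \<delta> $ j) \<and>
     (\<exists>a b.
        bij_betw (\<lambda>(p, q).
            (\<Sum>i\<in>UNIV. of_int (p $ i) *\<^sub>R a i) + (\<Sum>i\<in>UNIV. of_int (q $ i) *\<^sub>R b i)) UNIV L \<and>
        (\<forall>i j. E (a i) (a j) = 0 \<and> E (b i) (b j) = 0 \<and>
           E (a i) (b j) = (if i = j then of_int (\<delta> $ i) else 0)))"

definition divisor_induces_polarization_of_type ::
  "(complex^'k) set \<Rightarrow> (complex^'k \<Rightarrow> complex) \<Rightarrow> (complex^'k) set set
     \<Rightarrow> int^('n::{finite,linorder}) \<Rightarrow> bool" where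
  "divisor_induces_polarization_of_type \<Lambda> f M \<delta> \<longleftrightarrow>
     (\<exists>V E. subtorus \<Lambda> V M \<and> divisor_form \<Lambda> f E \<and>
        polarization V (V \<inter> \<Lambda>) E \<and> form_type (V \<inter> \<Lambda>) E \<delta>)"

text \<open>\<open>\<phi>\<close> is a homomorphism and holomorphic because it is induced by a linear map; being bijective,
  it is then an isomorphism of complex tori.\<close>

definition torus_isomorphism ::
  "(complex^'n) set \<Rightarrow> (complex^'k) set \<Rightarrow> (complex^'k) set set \<Rightarrow> complex^'n^'k \<Rightarrow> bool" where
  "torus_isomorphism L \<Lambda> M \<Phi> \<longleftrightarrow>
     (\<exists>\<phi>. bij_betw \<phi> (torus L) M \<and> (\<forall>z. \<phi> (torus_class L z) = torus_class \<Lambda> (\<Phi> *v z)))"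

definition representatives :: "int^'n \<Rightarrow> (int^'n) set \<Rightarrow> bool" where
  "representatives d R \<longleftrightarrow> (\<forall>m. \<exists>!\<epsilon>. \<epsilon> \<in> R \<and> (\<exists>k. cvec m - cvec \<epsilon> = cdiag d *v cvec k))"

definition coeff_index :: "complex^'n^'g \<Rightarrow> int^'n \<Rightarrow> int^'n \<Rightarrow> (int^'g) set" where
  "coeff_index \<Phi> \<delta> \<epsilon> = {m. transpose \<Phi> *v cvec m = matrix_inv (cdiag \<delta>) *v cvec \<epsilon>}"

definition coeff_term ::
  "complex^'g^'g \<Rightarrow> complex^'n^'n \<Rightarrow> int^'n^'g \<Rightarrow> int^'n \<Rightarrow> complex^'g \<Rightarrow> int^'n \<Rightarrow> int^'g \<Rightarrow> complex"
  where
  "coeff_term \<Omega>t \<Omega> P \<delta> \<gamma> \<epsilon> m =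
     exp (pi * \<i> * bil (cvec m) (\<Omega>t *v cvec m)
          - 2 * pi * \<i> * bil (cvec m) \<gamma>
          + 2 * pi * \<i> * bil (cvec \<epsilon>) (matrix_inv (cdiag \<delta>) *v (transpose (cmat P) *v \<gamma>))
          - pi * \<i> * bil (matrix_inv (cdiag \<delta>) *v cvec \<epsilon>)
                        (\<Omega> *v (matrix_inv (cdiag \<delta>) *v cvec \<epsilon>)))"

definition coeff ::
  "complex^'g^'g \<Rightarrow> complex^'n^'n \<Rightarrow> complex^'n^'g \<Rightarrow> int^'n^'g \<Rightarrow> int^'n \<Rightarrow> complex^'g \<Rightarrow> int^'n
     \<Rightarrow> complex" where
  "coeff \<Omega>t \<Omega> \<Phi> P \<delta> \<gamma> \<epsilon> = (\<Sum>\<^sub>\<infinity>m\<in>coeff_index \<Phi> \<delta> \<epsilon>. coeff_term \<Omega>t \<Omega> P \<delta> \<gamma> \<epsilon> m)"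

end

theory Submission
  imports Defs
begin

text \<open>
  Since \<open>\<Phi>\<Delta>\<close> is integral, \<open>\<Delta>\<Phi>\<^sup>Tm\<close> is an integer vector for every integer vector \<open>m\<close>, and so
  \<open>\<Phi>\<^sup>Tm = \<Delta>\<^sup>-\<^sup>1\<epsilon> + k\<close> for exactly one representative \<open>\<epsilon>\<close> and one integer vector \<open>k\<close>.  As
  \<open>\<Phi>\<^sup>TP = I\<close>, the vector \<open>m - Pk\<close> then is an index of the coefficient \<open>c\<^sub>\<epsilon>\<close>.  In terms of these new
  summation variables the theta series factorizes, because \<open>\<Phi>\<Omega> = \<Omega>tP\<close> and \<open>\<Omega> = P\<^sup>T\<Omega>tP\<close> split
  the quadratic form.
\<close>

section \<open>The pairing, integer vectors, diagonal matrices and residue classes\<close>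

lemma bil_add_left: "bil (x + y) z = bil x z + bil y z"
  by (simp add: bil_def distrib_right sum.distrib)

lemma bil_add_right: "bil x (y + z) = bil x y + bil x z"
  by (simp add: bil_def distrib_left sum.distrib)

lemma bil_diff_right: "bil x (y - z) = bil x y - bil x z"
  by (simp add: bil_def right_diff_distrib sum_subtractf)

lemma bil_commute: "bil x y = bil y x"
  by (simp add: bil_def mult.commute)

lemma bil_matrix_right: "bil x (A *v y) = bil (transpose A *v x) y"
  unfolding bil_def matrix_vector_mult_def transpose_def
  by (simp add: sum_distrib_left sum_distrib_right) (subst sum.swap, simp add: mult_ac)

lemma cvec_nth [simp]: "cvec m $ i = of_int (m $ i)"
  by (simp add: cvec_def)

lemma cvec_add: "cvec (m + k) = cvec m + cvec k"
  by (simp add: vec_eq_iff)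

lemma cvec_diff: "cvec (m - k) = cvec m - cvec k"
  by (simp add: vec_eq_iff)

lemma cvec_0 [simp]: "cvec 0 = 0"
  by (simp add: vec_eq_iff)

lemma cvec_matrix_mult: "cvec (A *v k) = cmat A *v cvec k"
  by (simp add: vec_eq_iff cmat_def matrix_vector_mult_def)

lemma cdiag_mult_nth [simp]: "(cdiag d *v x) $ i = of_int (d $ i) * x $ i"
  by (simp add: cdiag_def matrix_vector_mult_def if_distrib[of "\<lambda>u. u * _"] cong: if_cong)

lemma transpose_cdiag [simp]: "transpose (cdiag d) = cdiag d"
  by (auto simp: transpose_def cdiag_def vec_eq_iff)

text \<open>\<open>matrix_inv\<close> is a choice operator, so an explicit inverse is exhibited
  first; after that the defining equation of the chosen matrix determines its action coordinate by
  coordinate.\<close>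

lemma matrix_inv_cdiag_mult_nth:
  assumes "\<forall>i. d $ i \<noteq> 0"
  shows "(matrix_inv (cdiag d) *v x) $ i = x $ i / of_int (d $ i)"
proof -
  let ?B = "(\<chi> i j. if i = j then 1 / of_int (d $ i) else 0) :: complex^'a^'a"
  have "cdiag d ** ?B = mat 1"
    using assms by (simp add: matrix_matrix_mult_def cdiag_def mat_def vec_eq_iff
        if_distrib[of "\<lambda>u. u * _"] cong: if_cong)
  then have "invertible (cdiag d)"
    using invertible_right_inverse by blast
  then have "cdiag d ** matrix_inv (cdiag d) = mat 1"
    unfolding invertible_def matrix_inv_def by (rule someI_ex[THEN conjunct1])
  then have "cdiag d *v (matrix_inv (cdiag d) *v x) = x"
    by (simp add: matrix_vector_mul_assoc)
  then have "of_int (d $ i) * (matrix_inv (cdiag d) *v x) $ i = x $ i"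
    by (metis cdiag_mult_nth)
  then show ?thesis
    using assms by (simp add: field_simps)
qed

lemma bil_matrix_inv_cdiag:
  assumes "\<forall>i. d $ i \<noteq> 0"
  shows "bil x (matrix_inv (cdiag d) *v y) = bil (matrix_inv (cdiag d) *v x) y"
  by (simp add: bil_def matrix_inv_cdiag_mult_nth[OF assms])

text \<open>Coordinatewise reduction modulo \<open>d\<close> is injective on \<open>R\<close> and
  takes its values in a finite box.\<close>

lemma representatives_finite:
  assumes pos: "\<forall>i. 0 < d $ i" and R: "representatives d R"
  shows "finite R"
proof (rule inj_on_finite)
  let ?f = "\<lambda>\<epsilon>::int^'a. \<lambda>i. \<epsilon> $ i mod d $ i"
  show "inj_on ?f R"
  proof (rule inj_onI)
    fix x y assume xy: "x \<in> R" "y \<in> R" "?f x = ?f y"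
    define k :: "int^'a" where "k = (\<chi> i. (x $ i - y $ i) div d $ i)"
    have "x $ i - y $ i = d $ i * k $ i" for i
    proof -
      have "d $ i dvd x $ i - y $ i"
        using fun_cong[OF xy(3)] by (simp add: mod_eq_dvd_iff)
      then show ?thesis by (simp add: k_def)
    qed
    then have "cvec x - cvec y = cdiag d *v cvec k"
      by (simp add: vec_eq_iff flip: of_int_diff of_int_mult)
    \<comment> \<open>Both \<open>x\<close> and \<open>y\<close> now represent the class of
      \<open>x\<close>, so the uniqueness in \<open>representatives\<close> identifies them.\<close>
    moreover have "cvec x - cvec x = cdiag d *v cvec 0"
      by simp
    ultimately show "x = y"
      using R xy unfolding representatives_def by metis
  qed
  show "?f ` R \<subseteq> PiE UNIV (\<lambda>i. {0..<d $ i})"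
    using pos by auto
  show "finite (PiE UNIV (\<lambda>i. {0..<d $ i}))"
    by (intro finite_PiE) auto
qed

section \<open>Gaussian sums over integer vectors and positive definite forms\<close>

lemma summable_on_int_exp: "(\<lambda>n::int. exp (- \<bar>real_of_int n\<bar>)) summable_on UNIV"
proof -
  have "summable (\<lambda>n::nat. exp (- 1 :: real) ^ n)"
    by (rule summable_geometric) simp
  then have geo: "(\<lambda>n::nat. exp (- real n)) summable_on UNIV"
    by (subst summable_on_UNIV_nonneg_real_iff) (simp_all flip: exp_of_nat_mult)
  have "bij_betw int UNIV {0..}"
    by (rule bij_betwI[where g = nat]) auto
  moreover have "bij_betw (\<lambda>n. - int n) UNIV {..0}"
    by (rule bij_betwI[where g = "\<lambda>n. nat (- n)"]) auto
  note calculation this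
  from this[THEN summable_on_reindex_bij_betw, of "\<lambda>n. exp (- \<bar>real_of_int n\<bar>)"] geo
  \<comment> \<open>Each half is a geometric series. Both halves contain 0, but only summability is
    claimed, so the overlap does no harm.\<close>
  have "(\<lambda>n. exp (- \<bar>real_of_int n\<bar>)) summable_on ({0..} \<union> {..0})"
    by (intro summable_on_union) simp_all
  moreover have "{0..} \<union> {..0} = (UNIV :: int set)"
    by auto
  ultimately show ?thesis by simp
qed

text \<open>A finite set of vectors lies in the box spanned by its coordinate projections. Over a
  box the sum of the products is the product of the sums, and by nonnegativity this stays below the
  product of the full sums.\<close>

lemma summable_on_prod_vec:
  fixes f :: "'k::finite \<Rightarrow> 'a \<Rightarrow> real"
  assumes nonneg: "\<And>i x. 0 \<le> f i x" and sum: "\<And>i. f i summable_on UNIV"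
  shows "(\<lambda>v :: 'a^'k. \<Prod>i\<in>UNIV. f i (v $ i)) summable_on UNIV"
proof (rule nonneg_bdd_above_summable_on)
  show "0 \<le> (\<Prod>i\<in>UNIV. f i (v $ i))" for v :: "'a^'k"
    by (simp add: nonneg prod_nonneg)
  show "bdd_above (sum (\<lambda>v :: 'a^'k. \<Prod>i\<in>UNIV. f i (v $ i)) ` {F. F \<subseteq> UNIV \<and> finite F})"
  proof (rule bdd_aboveI2)
    fix F :: "('a^'k) set" assume "F \<in> {F. F \<subseteq> UNIV \<and> finite F}"
    then have fin: "finite F" by simp
    define B where "B i = (\<lambda>v. v $ i) ` F" for i
    have finB: "finite (B i)" for i
      using fin by (simp add: B_def)
    \<comment> \<open>Vectors are replaced by their coordinate functions, because the distributive
      law \<open>prod_sum_PiE\<close> concerns functions.\<close>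
    have "(\<Sum>v\<in>F. \<Prod>i\<in>UNIV. f i (v $ i)) = (\<Sum>g\<in>vec_nth ` F. \<Prod>i\<in>UNIV. f i (g i))"
      by (subst sum.reindex) (auto simp: inj_on_def vec_nth_inject)
    also have "\<dots> \<le> (\<Sum>g\<in>PiE UNIV B. \<Prod>i\<in>UNIV. f i (g i))"
      by (intro sum_mono2 finite_PiE finB) (auto simp: B_def prod_nonneg nonneg)
    also have "\<dots> = (\<Prod>i\<in>UNIV. \<Sum>x\<in>B i. f i x)"
      by (intro prod_sum_PiE[symmetric]) (simp_all add: finB)
    also have "\<dots> \<le> (\<Prod>i\<in>UNIV. infsum (f i) UNIV)"
      by (intro prod_mono conjI sum_nonneg nonneg finite_sum_le_infsum sum finB) simp_all
    finally show "(\<Sum>v\<in>F. \<Prod>i\<in>UNIV. f i (v $ i)) \<le> (\<Prod>i\<in>UNIV. infsum (f i) UNIV)" .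
  qed
qed

lemma summable_on_gaussian_vec:
  fixes b :: "'k::finite \<Rightarrow> real"
  assumes "0 < c"
  shows "(\<lambda>n :: int^'k. \<Prod>i\<in>UNIV. exp (b i * \<bar>real_of_int (n $ i)\<bar> - c * (real_of_int (n $ i))\<^sup>2))
    summable_on UNIV"
proof (rule summable_on_prod_vec)
  fix i
  have "exp (b i * \<bar>real_of_int x\<bar> - c * (real_of_int x)\<^sup>2)
      \<le> exp ((b i + 1)\<^sup>2 / (4 * c)) * exp (- \<bar>real_of_int x\<bar>)" for x
  proof -
    let ?t = "\<bar>real_of_int x\<bar>"
    \<comment> \<open>Completing the square with slope \<open>b i + 1\<close> instead of
      \<open>b i\<close>: the extra 1 leaves the summable factor \<open>exp (- ?t)\<close>.\<close>
    have "0 \<le> c * (?t - (b i + 1) / (2 * c))\<^sup>2"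
      using assms by simp
    also have "\<dots> = c * ?t\<^sup>2 - (b i + 1) * ?t + (b i + 1)\<^sup>2 / (4 * c)"
      using assms by (simp add: field_simps power2_eq_square)
    finally show ?thesis
      by (simp add: algebra_simps flip: exp_add)
  qed
  then show "(\<lambda>x. exp (b i * \<bar>real_of_int x\<bar> - c * (real_of_int x)\<^sup>2)) summable_on UNIV"
    by (intro summable_on_comparison_test[OF summable_on_cmult_right[OF summable_on_int_exp]]) auto
qed simp

text \<open>The constant is the minimum of the quadratic form on the unit sphere: it is attained by
  compactness, hence positive, and homogeneity of degree 2 extends the bound to all vectors.\<close>

lemma positive_definite_coercive:
  fixes A :: "real^'k^'k"
  assumes pos: "\<And>x. x \<noteq> 0 \<Longrightarrow> 0 < x \<bullet> (A *v x)"
  obtains c where "0 < c" "\<And>x. c * (norm x)\<^sup>2 \<le> x \<bullet> (A *v x)"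
proof -
  have "continuous_on (sphere 0 1) (\<lambda>x :: real^'k. x \<bullet> (A *v x))"
    by (intro continuous_intros)
  moreover have "(sphere 0 1 :: (real^'k) set) \<noteq> {}"
    by simp
  ultimately obtain u :: "real^'k" where "u \<in> sphere 0 1"
    and "\<forall>x\<in>sphere 0 1. u \<bullet> (A *v u) \<le> x \<bullet> (A *v x)"
    using continuous_attains_inf[OF compact_sphere] by blast
  then have u: "norm u = 1" and min: "\<And>x. norm x = 1 \<Longrightarrow> u \<bullet> (A *v u) \<le> x \<bullet> (A *v x)"
    by simp_all
  show thesis
  proof (rule that)
    show "0 < u \<bullet> (A *v u)"
      using u by (intro pos) auto
    fix x :: "real^'k"
    show "(u \<bullet> (A *v u)) * (norm x)\<^sup>2 \<le> x \<bullet> (A *v x)"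
    proof (cases "x = 0")
      case False
      have "u \<bullet> (A *v u) \<le> (x /\<^sub>R norm x) \<bullet> (A *v (x /\<^sub>R norm x))"
        using False by (intro min) simp
      also have "\<dots> = x \<bullet> (A *v x) / (norm x)\<^sup>2"
        using False by (simp add: matrix_vector_mult_scaleR power2_eq_square field_simps)
      finally show ?thesis
        using False by (simp add: field_simps)
    qed simp
  qed
qed

section \<open>Absolute convergence of theta series\<close>

text \<open>The argument \<open>v\<close> is an arbitrary complex vector, so that one formula covers
  the summands of \<open>theta\<close> as well as those of \<open>theta_char\<close>, whose
  summation index is shifted by the characteristic.\<close>

definition theta_term :: "complex^'k^'k \<Rightarrow> complex^'k \<Rightarrow> complex^'k \<Rightarrow> complex" where
  "theta_term \<Omega> z v = exp (pi * \<i> * bil v (\<Omega> *v v) + 2 * pi * \<i> * bil v z)"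

lemma theta_eq_infsum: "theta z \<Omega> = (\<Sum>\<^sub>\<infinity>n. theta_term \<Omega> z (cvec n))"
  by (simp add: theta_def theta_char_def theta_term_def)

lemma theta_char_0_eq_infsum: "theta_char a 0 z \<Omega> = (\<Sum>\<^sub>\<infinity>n. theta_term \<Omega> z (cvec n + a))"
  by (simp add: theta_char_def theta_term_def)

text \<open>The norm of \<open>exp w\<close> is \<open>exp (Re w)\<close>, and as \<open>n\<close>
  is real, the factor \<open>\<i>\<close> leaves only the imaginary parts of \<open>\<Omega>\<close>
  and \<open>z\<close>.\<close>

lemma norm_theta_term:
  fixes n :: "int^'k"
  defines "x \<equiv> (\<chi> i. real_of_int (n $ i))"
  shows "norm (theta_term \<Omega> z (cvec n)) =
    exp (- pi * (x \<bullet> ((\<chi> i j. Im (\<Omega> $ i $ j)) *v x)) - 2 * pi * (\<Sum>i\<in>UNIV. x $ i * Im (z $ i)))"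
  by (simp add: theta_term_def x_def bil_def inner_vec_def matrix_vector_mult_def sum_distrib_left
      sum_negf)

text \<open>By coercivity of the imaginary part of \<open>\<Omega>\<close> the quadratic term is at
  least a multiple of the squared norm, which dominates the linear term. The majorant splits into
  one Gaussian factor per coordinate.\<close>

lemma theta_term_summable:
  fixes \<Omega> :: "complex^'k^'k"
  assumes "siegel \<Omega>"
  shows "(\<lambda>n. theta_term \<Omega> z (cvec n)) summable_on UNIV"
proof -
  let ?Y = "(\<chi> i j. Im (\<Omega> $ i $ j)) :: real^'k^'k"
  obtain c where c: "0 < c" "\<And>x. c * (norm x)\<^sup>2 \<le> x \<bullet> (?Y *v x)"
    using positive_definite_coercive[of ?Y] assms unfolding siegel_def by blast
  have bound: "norm (theta_term \<Omega> z (cvec n)) \<le> (\<Prod>i\<in>UNIV. exp (2 * pi * \<bar>Im (z $ i)\<bar> *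
      \<bar>real_of_int (n $ i)\<bar> - pi * c * (real_of_int (n $ i))\<^sup>2))" for n :: "int^'k"
  proof -
    let ?x = "(\<chi> i. real_of_int (n $ i)) :: real^'k"
    have "- (?x $ i * Im (z $ i)) \<le> \<bar>Im (z $ i)\<bar> * \<bar>real_of_int (n $ i)\<bar>" for i
      using abs_ge_minus_self[of "?x $ i * Im (z $ i)"] by (simp add: abs_mult mult.commute)
    then have lin: "- (\<Sum>i\<in>UNIV. ?x $ i * Im (z $ i))
        \<le> (\<Sum>i\<in>UNIV. \<bar>Im (z $ i)\<bar> * \<bar>real_of_int (n $ i)\<bar>)"
      unfolding sum_negf[symmetric] by (rule sum_mono)
    have quad: "c * (\<Sum>i\<in>UNIV. (real_of_int (n $ i))\<^sup>2) \<le> ?x \<bullet> (?Y *v ?x)"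
      using c(2)[of ?x] unfolding power2_norm_eq_inner by (simp add: inner_vec_def power2_eq_square)
    have "- pi * (?x \<bullet> (?Y *v ?x)) - 2 * pi * (\<Sum>i\<in>UNIV. ?x $ i * Im (z $ i))
        \<le> - pi * (c * (\<Sum>i\<in>UNIV. (real_of_int (n $ i))\<^sup>2))
          + 2 * pi * (\<Sum>i\<in>UNIV. \<bar>Im (z $ i)\<bar> * \<bar>real_of_int (n $ i)\<bar>)"
      using mult_left_mono[OF lin pi_ge_zero] mult_left_mono[OF quad pi_ge_zero]
      unfolding mult.assoc by linarith
    also have "\<dots> = (\<Sum>i\<in>UNIV. 2 * pi * \<bar>Im (z $ i)\<bar> * \<bar>real_of_int (n $ i)\<bar>
        - pi * c * (real_of_int (n $ i))\<^sup>2)"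
      by (simp add: sum_subtractf sum_negf sum_distrib_left mult_ac)
    finally show ?thesis
      by (simp add: norm_theta_term flip: exp_sum)
  qed
  have "(\<lambda>n :: int^'k. \<Prod>i\<in>UNIV. exp (2 * pi * \<bar>Im (z $ i)\<bar> *
      \<bar>real_of_int (n $ i)\<bar> - pi * c * (real_of_int (n $ i))\<^sup>2)) summable_on UNIV"
    using c(1) by (intro summable_on_gaussian_vec) simp
  then have "(\<lambda>n. norm (theta_term \<Omega> z (cvec n))) summable_on UNIV"
    by (rule Infinite_Sum.abs_summable_on_comparison_test') (rule bound)
  then show ?thesis by (rule abs_summable_summable)
qed

section \<open>Factorization of a single theta term\<close>

text \<open>All terms involving \<open>P *v k\<close> can be expressed through \<open>k\<close> and
  \<open>a = \<Delta>\<^sup>-\<^sup>1\<epsilon>\<close>. The last two summands in the exponent of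
  \<open>coeff_term\<close> cancel what the shift of \<open>k\<close> by \<open>a\<close> adds on
  the right: the value of the quadratic form at \<open>a\<close> and the pairing of \<open>a\<close>
  with \<open>P\<^sup>T\<gamma>\<close>.\<close>

lemma theta_term_factor:
  fixes \<Omega>t :: "complex^'g^'g" and \<Phi> :: "complex^'n^'g" and P :: "int^'n^'g"
  assumes sym: "transpose \<Omega>t = \<Omega>t"
    and \<Phi>\<Omega>: "\<Phi> ** \<Omega> = \<Omega>t ** cmat P"
    and P\<Phi>: "transpose (cmat P) ** \<Phi> = mat 1"
    and \<Omega>: "\<Omega> = transpose (cmat P) ** \<Omega>t ** cmat P"
    and \<delta>: "\<forall>i. \<delta> $ i \<noteq> 0"
    and m: "m \<in> coeff_index \<Phi> \<delta> \<epsilon>"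
  shows "theta_term \<Omega>t (\<Phi> *v z - \<gamma>) (cvec (m + P *v k)) = coeff_term \<Omega>t \<Omega> P \<delta> \<gamma> \<epsilon> m *
    theta_term \<Omega> (z - transpose (cmat P) *v \<gamma>) (cvec k + matrix_inv (cdiag \<delta>) *v cvec \<epsilon>)"
proof -
  define a where "a = matrix_inv (cdiag \<delta>) *v cvec \<epsilon>"
  define p where "p = cmat P *v cvec k"
  have a: "transpose \<Phi> *v cvec m = a"
    using m by (simp add: coeff_index_def a_def)
  have "transpose \<Phi> ** cmat P = mat 1"
    using arg_cong[OF P\<Phi>, of transpose] by (simp add: matrix_transpose_mul)
  then have k: "transpose \<Phi> *v p = cvec k"
    by (simp add: p_def matrix_vector_mul_assoc del: transpose_matrix_vector)
  \<comment> \<open>This symmetry makes the two mixed terms of \<open>k\<close> and \<open>a\<close>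
    equal in \<open>q4\<close>.\<close>
  have sym\<Omega>: "transpose \<Omega> = \<Omega>"
    by (simp add: \<Omega> matrix_transpose_mul sym matrix_mul_assoc)
  \<comment> \<open>The vector \<open>\<Omega>t *v p\<close> lies in the image of
    \<open>\<Phi>\<close>, so pairing with it passes through \<open>\<Phi>\<^sup>T\<close>, which
    sends \<open>m\<close> to \<open>a\<close> and \<open>p\<close> to \<open>k\<close>.\<close>
  have \<Omega>tp: "\<Omega>t *v p = \<Phi> *v (\<Omega> *v cvec k)"
    by (simp add: p_def matrix_vector_mul_assoc \<Phi>\<Omega>)
  have q1: "bil (cvec m) (\<Omega>t *v p) = bil a (\<Omega> *v cvec k)"
    by (simp add: \<Omega>tp bil_matrix_right[of _ \<Phi>] a del: transpose_matrix_vector)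
  have q2: "bil p (\<Omega>t *v p) = bil (cvec k) (\<Omega> *v cvec k)"
    by (simp add: \<Omega>tp bil_matrix_right[of _ \<Phi>] k del: transpose_matrix_vector)
  have q3: "bil p (\<Omega>t *v cvec m) = bil a (\<Omega> *v cvec k)"
    using q1 bil_commute bil_matrix_right[of p \<Omega>t "cvec m"] sym by metis
  have q4: "bil (cvec k) (\<Omega> *v a) = bil a (\<Omega> *v cvec k)"
    using bil_commute bil_matrix_right[of "cvec k" \<Omega> a] sym\<Omega> by metis
  have l1: "bil (cvec m) (\<Phi> *v z) = bil a z" "bil p (\<Phi> *v z) = bil (cvec k) z"
    by (simp_all add: bil_matrix_right[of _ \<Phi>] a k del: transpose_matrix_vector)
  have l2: "bil p \<gamma> = bil (cvec k) (transpose (cmat P) *v \<gamma>)"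
    by (simp add: p_def bil_matrix_right[of "cvec k"] del: transpose_matrix_vector)
  have l3: "bil (cvec \<epsilon>) (matrix_inv (cdiag \<delta>) *v (transpose (cmat P) *v \<gamma>))
      = bil a (transpose (cmat P) *v \<gamma>)"
    by (simp only: bil_matrix_inv_cdiag[OF \<delta>] a_def)
  show ?thesis
    unfolding theta_term_def coeff_term_def cvec_add cvec_matrix_mult exp_add[symmetric]
      a_def[symmetric] p_def[symmetric] l3
    unfolding matrix_vector_right_distrib bil_add_left bil_add_right bil_diff_right l1 l2 q1 q2 q3 q4
    by (rule arg_cong[of _ _ exp]) (simp add: algebra_simps)
qed

section \<open>Reindexing the integer vectors by residue classes\<close>

text \<open>Coordinate \<open>j\<close> of the product is the pairing of \<open>m\<close> with
  column \<open>j\<close> of \<open>A\<close>, an integer vector by assumption.\<close>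

lemma transpose_mult_integral:
  fixes A :: "complex^'n^'g"
  assumes "range (\<lambda>k. A *v cvec k) \<subseteq> range cvec"
  obtains k where "transpose A *v cvec m = cvec k"
proof -
  have "\<exists>t. bil (cvec m) (A *v cvec (axis j 1)) = of_int t" for j
  proof -
    obtain l where "A *v cvec (axis j 1) = cvec l"
      using assms by blast
    then have "bil (cvec m) (A *v cvec (axis j 1)) = of_int (\<Sum>i\<in>UNIV. m $ i * l $ i)"
      by (simp add: bil_def)
    then show ?thesis ..
  qed
  then obtain t where t: "bil (cvec m) (A *v cvec (axis j 1)) = of_int (t j)" for j
    by metis
  have "bil x (cvec (axis j 1)) = x $ j" for x :: "complex^'n" and j
    by (simp add: bil_def axis_def if_distrib[of "\<lambda>u. _ * of_int u"] cong: if_cong)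
  then have "transpose A *v cvec m = cvec (\<chi> j. t j)"
    using t unfolding bil_matrix_right by (simp add: vec_eq_iff del: transpose_matrix_vector)
  then show thesis by (rule that)
qed

text \<open>For a given integer vector \<open>s\<close>, the class of
  \<open>\<Delta>\<Phi>\<^sup>Ts\<close> determines \<open>\<epsilon>\<close>, the quotient in the
  congruence determines \<open>k\<close>, and then \<open>m = s - P *v k\<close>.\<close>

lemma bij_betw_representatives:
  fixes \<Phi> :: "complex^'n^'g" and P :: "int^'n^'g"
  assumes int: "range (\<lambda>k. \<Phi> *v (cdiag \<delta> *v cvec k)) \<subseteq> range cvec"
    and P\<Phi>: "transpose (cmat P) ** \<Phi> = mat 1"
    and \<delta>: "\<forall>i. \<delta> $ i \<noteq> 0"
    and R: "representatives \<delta> R"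
  shows "bij_betw (\<lambda>(\<epsilon>, m, k). m + P *v k) (SIGMA \<epsilon>:R. coeff_index \<Phi> \<delta> \<epsilon> \<times> UNIV) UNIV"
proof -
  have "transpose \<Phi> ** cmat P = mat 1"
    using arg_cong[OF P\<Phi>, of transpose] by (simp add: matrix_transpose_mul)
  then have k: "transpose \<Phi> *v cvec (P *v k) = cvec k" for k
    by (simp add: cvec_matrix_mult matrix_vector_mul_assoc del: transpose_matrix_vector)
  have inv: "matrix_inv (cdiag \<delta>) *v x = y \<longleftrightarrow> x = cdiag \<delta> *v y" for x y
    using \<delta> by (auto simp: vec_eq_iff matrix_inv_cdiag_mult_nth[OF \<delta>] field_simps)
  \<comment> \<open>Multiplying by \<open>\<Delta>\<close> turns membership in the index set into
    the congruence that defines \<open>representatives\<close>, with \<open>k\<close> as the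
    quotient.\<close>
  have idx: "m - P *v k \<in> coeff_index \<Phi> \<delta> \<epsilon> \<longleftrightarrow>
      cdiag \<delta> *v (transpose \<Phi> *v cvec m) - cvec \<epsilon> = cdiag \<delta> *v cvec k" for m k \<epsilon>
    unfolding coeff_index_def mem_Collect_eq cvec_diff matrix_vector_mult_diff_distrib k
      eq_commute[of _ "matrix_inv _ *v _"] inv
    by (auto simp: algebra_simps)
  have ex1: "\<exists>!\<epsilon>. \<epsilon> \<in> R \<and> (\<exists>k. m - P *v k \<in> coeff_index \<Phi> \<delta> \<epsilon>)" for m
  proof -
    \<comment> \<open>Integrality of \<open>\<Phi>\<Delta>\<close> makes
      \<open>\<Delta>\<Phi>\<^sup>Tm\<close> an integer vector, to which
      \<open>representatives\<close> applies.\<close>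
    have "transpose (\<Phi> ** cdiag \<delta>) *v cvec m = cdiag \<delta> *v (transpose \<Phi> *v cvec m)"
      by (simp add: matrix_transpose_mul matrix_vector_mul_assoc del: transpose_matrix_vector)
    then obtain l where "cdiag \<delta> *v (transpose \<Phi> *v cvec m) = cvec l"
      using transpose_mult_integral[of "\<Phi> ** cdiag \<delta>" m] int
      by (metis (no_types, lifting) matrix_vector_mul_assoc image_cong)
    then show ?thesis
      unfolding idx using R unfolding representatives_def by simp
  qed
  have uniq: "k = k'" if "m - P *v k \<in> coeff_index \<Phi> \<delta> \<epsilon>" "m - P *v k' \<in> coeff_index \<Phi> \<delta> \<epsilon>" for m k k' \<epsilon>
    using that \<delta> unfolding idx by (simp add: vec_eq_iff)
  show ?thesis
    unfolding bij_betw_def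
  proof (intro conjI inj_onI set_eqI iffI UNIV_I)
    fix x y
    assume "x \<in> (SIGMA \<epsilon>:R. coeff_index \<Phi> \<delta> \<epsilon> \<times> UNIV)" "y \<in> (SIGMA \<epsilon>:R. coeff_index \<Phi> \<delta> \<epsilon> \<times> UNIV)"
      and eq: "(\<lambda>(\<epsilon>, m, k). m + P *v k) x = (\<lambda>(\<epsilon>, m, k). m + P *v k) y"
    then obtain \<epsilon> m k \<epsilon>' m' k' where xy: "x = (\<epsilon>, m, k)" "y = (\<epsilon>', m', k')"
      and R: "\<epsilon> \<in> R" "\<epsilon>' \<in> R"
      and m: "m \<in> coeff_index \<Phi> \<delta> \<epsilon>" "m' \<in> coeff_index \<Phi> \<delta> \<epsilon>'"
      by auto
    \<comment> \<open>Both triples are read off from their common image \<open>s\<close>: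
      \<open>ex1\<close> gives equal classes, then \<open>uniq\<close> gives equal
      quotients.\<close>
    define s where "s = m + P *v k"
    have "s = m' + P *v k'"
      using eq by (simp add: s_def xy)
    then have s: "m = s - P *v k" "m' = s - P *v k'"
      by (metis s_def add_diff_cancel_right') (metis \<open>s = m' + P *v k'\<close> add_diff_cancel_right')
    have "\<epsilon> = \<epsilon>'"
      using ex1[of s] R m s by metis
    then show "x = y"
      using uniq m s xy by metis
  next
    fix m
    obtain \<epsilon> k where "\<epsilon> \<in> R" "m - P *v k \<in> coeff_index \<Phi> \<delta> \<epsilon>"
      using ex1 by blast
    then show "m \<in> (\<lambda>(\<epsilon>, m, k). m + P *v k) ` (SIGMA \<epsilon>:R. coeff_index \<Phi> \<delta> \<epsilon> \<times> UNIV)"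
      by (intro image_eqI[of _ _ "(\<epsilon>, m - P *v k, k)"]) auto
  qed
qed

section \<open>Rearrangement of the theta series\<close>

theorem theorem2:
  fixes dt :: "int^'g" and \<Omega>t :: "complex^'g^'g"
    and M :: "(complex^'g) set set"
    and \<delta> :: "int^('n::{finite,linorder})" and \<Omega> :: "complex^('n::{finite,linorder})^('n::{finite,linorder})"
    and \<Phi> :: "complex^('n::{finite,linorder})^'g" and P :: "int^('n::{finite,linorder})^'g"
    and R :: "(int^('n::{finite,linorder})) set" and z :: "complex^('n::{finite,linorder})" and \<gamma> :: "complex^'g"
  assumes "\<forall>i. 0 < dt $ i"
    and "siegel \<Omega>t"
    and "abelian_variety (period_lattice dt \<Omega>t)"
    and "abelian_subvariety (period_lattice dt \<Omega>t) M CARD('n)"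
    and "divisor_induces_polarization_of_type (period_lattice dt \<Omega>t) (\<lambda>w. theta w \<Omega>t) M \<delta>"
    and "siegel \<Omega>"
    and "torus_isomorphism (period_lattice \<delta> \<Omega>) (period_lattice dt \<Omega>t) M \<Phi>"
    and "theta_function \<delta> \<Omega> (\<lambda>w. theta (\<Phi> *v w) \<Omega>t)"
    and "range (\<lambda>k. \<Phi> *v (cdiag \<delta> *v cvec k)) \<subseteq> range (\<lambda>m. cdiag dt *v cvec m)"
    and "\<Phi> ** \<Omega> = \<Omega>t ** cmat P"
    and "transpose (cmat P) ** \<Phi> = mat 1"
    and "\<Omega> = transpose (cmat P) ** \<Omega>t ** cmat P"
    and "representatives \<delta> R"
  shows "(\<forall>\<epsilon>\<in>R. coeff_term \<Omega>t \<Omega> P \<delta> \<gamma> \<epsilon> summable_on coeff_index \<Phi> \<delta> \<epsilon>) \<and>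
    theta (\<Phi> *v z - \<gamma>) \<Omega>t =
      (\<Sum>\<epsilon>\<in>R. coeff \<Omega>t \<Omega> \<Phi> P \<delta> \<gamma> \<epsilon> *
        theta_char (matrix_inv (cdiag \<delta>) *v cvec \<epsilon>) 0 (z - transpose (cmat P) *v \<gamma>) \<Omega>)"
proof -
  note int = assms(9) and \<Phi>\<Omega> = assms(10) and P\<Phi> = assms(11) and \<Omega> = assms(12) and R = assms(13)
  \<comment> \<open>Positivity of the \<open>\<delta> $ i\<close> is part of the type of the
    polarization.\<close>
  have pos: "\<forall>i. 0 < \<delta> $ i"
    using assms(5) by (auto simp: divisor_induces_polarization_of_type_def form_type_def)
  then have \<delta>: "\<forall>i. \<delta> $ i \<noteq> 0"
    by (metis less_irrefl)
  have finR: "finite R"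
    using representatives_finite[OF pos R] .
  have "cdiag dt *v cvec m = cvec (\<chi> i. dt $ i * m $ i)" for m
    by (simp add: vec_eq_iff)
  then have "range (\<lambda>k. \<Phi> *v (cdiag \<delta> *v cvec k)) \<subseteq> range cvec"
    using int by auto
  note bij = bij_betw_representatives[OF this P\<Phi> \<delta> R]
  let ?I = "\<lambda>\<epsilon>. coeff_index \<Phi> \<delta> \<epsilon>"
  let ?c = "coeff_term \<Omega>t \<Omega> P \<delta> \<gamma>"
  let ?t = "\<lambda>\<epsilon> k. theta_term \<Omega> (z - transpose (cmat P) *v \<gamma>)
      (cvec k + matrix_inv (cdiag \<delta>) *v cvec \<epsilon>)"
  define F where "F = (\<lambda>(\<epsilon>, m, k). ?c \<epsilon> m * ?t \<epsilon> k)"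
  have sym: "transpose \<Omega>t = \<Omega>t"
    using assms(2) by (simp add: siegel_def)
  have F: "F x = theta_term \<Omega>t (\<Phi> *v z - \<gamma>) (cvec ((\<lambda>(\<epsilon>, m, k). m + P *v k) x))"
    if "x \<in> Sigma R (\<lambda>\<epsilon>. ?I \<epsilon> \<times> UNIV)" for x
    using that theta_term_factor[OF sym \<Phi>\<Omega> P\<Phi> \<Omega> \<delta>] by (auto simp: F_def)
  \<comment> \<open>Convergence of the double family is inherited from the theta series of
    \<open>\<Omega>t\<close> along the bijection.\<close>
  have sumF: "F summable_on Sigma R (\<lambda>\<epsilon>. ?I \<epsilon> \<times> UNIV)"
    using theta_term_summable[OF assms(2)] summable_on_reindex_bij_betw[OF bij] F
    by (metis (no_types, lifting) summable_on_cong)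
  have sum\<epsilon>: "(\<lambda>(m, k). ?c \<epsilon> m * ?t \<epsilon> k) summable_on ?I \<epsilon> \<times> UNIV" if "\<epsilon> \<in> R" for \<epsilon>
    using summable_on_SigmaD1[of "\<lambda>\<epsilon> y. F (\<epsilon>, y)"] sumF that
    by (simp add: F_def case_prod_unfold)
  \<comment> \<open>A non-summable family has \<open>infsum\<close> 0 by convention, so convergence
    of the coefficients is claimed and proved separately. The slice \<open>k = 0\<close> of the
    double family is the coefficient series times a constant, and this constant is an exponential,
    hence nonzero.\<close>
  have coeff_summable: "?c \<epsilon> summable_on ?I \<epsilon>" if "\<epsilon> \<in> R" for \<epsilon>
  proof -
    have "(\<lambda>(m, k). ?c \<epsilon> m * ?t \<epsilon> k) summable_on ?I \<epsilon> \<times> {0}"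
      using sum\<epsilon>[OF that] by (rule summable_on_subset_banach) auto
    moreover have "bij_betw (\<lambda>m. (m, 0)) (?I \<epsilon>) (?I \<epsilon> \<times> {0 :: int^('n::{finite,linorder})})"
      by (auto intro: bij_betwI[where g = fst])
    ultimately have "(\<lambda>m. ?c \<epsilon> m * ?t \<epsilon> 0) summable_on ?I \<epsilon>"
      by (simp flip: summable_on_reindex_bij_betw)
    moreover have "?t \<epsilon> 0 \<noteq> 0"
      by (simp add: theta_term_def)
    ultimately show ?thesis
      by (simp add: summable_on_cmult_left')
  qed
  have "theta (\<Phi> *v z - \<gamma>) \<Omega>t = infsum F (Sigma R (\<lambda>\<epsilon>. ?I \<epsilon> \<times> UNIV))"
    unfolding theta_eq_infsum infsum_reindex_bij_betw[OF bij, symmetric]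
    by (intro infsum_cong F[symmetric])
  also have "\<dots> = (\<Sum>\<^sub>\<infinity>\<epsilon>\<in>R. \<Sum>\<^sub>\<infinity>x\<in>?I \<epsilon> \<times> UNIV. F (\<epsilon>, x))"
    \<comment> \<open>Fubini for the summable family \<open>F\<close>; the outer sum becomes finite
      because \<open>R\<close> is.\<close>
    using infsum_Sigma'_banach[of "\<lambda>\<epsilon> x. F (\<epsilon>, x)"] sumF by simp
  also have "\<dots> = (\<Sum>\<epsilon>\<in>R. \<Sum>\<^sub>\<infinity>x\<in>?I \<epsilon> \<times> UNIV. F (\<epsilon>, x))"
    using finR by simp
  also have "\<dots> = (\<Sum>\<epsilon>\<in>R. \<Sum>\<^sub>\<infinity>m\<in>?I \<epsilon>. \<Sum>\<^sub>\<infinity>k. ?c \<epsilon> m * ?t \<epsilon> k)"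
    using sum\<epsilon> by (intro sum.cong refl) (simp add: infsum_Sigma'_banach F_def case_prod_unfold)
  also have "\<dots> = (\<Sum>\<epsilon>\<in>R. coeff \<Omega>t \<Omega> \<Phi> P \<delta> \<gamma> \<epsilon> *
      theta_char (matrix_inv (cdiag \<delta>) *v cvec \<epsilon>) 0 (z - transpose (cmat P) *v \<gamma>) \<Omega>)"
    \<comment> \<open>The coefficient leaves the sum over \<open>k\<close>, then the theta series
      leaves the sum over \<open>m\<close>; in a field both rules hold unconditionally.\<close>
    by (simp only: infsum_cmult_right' infsum_cmult_left' coeff_def theta_char_0_eq_infsum)
  finally show ?thesis
    using coeff_summable by blast
qed

end
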